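(* Let $M\in\mathbb N$ and let $A^-=(A^-(\delta,\delta'))_{\delta,\delta'\in\{0,1\}}$, $A=(A(\delta,\delta'))_{\delta,\delta'\in\{0,1\}}$, $A^+=(A^+(\delta,\delta'))_{\delta,\delta'\in\{0,1\}}$ be matrices with entries in $\mathbb Z_+$ such that $$A^-(\delta,\delta'),\ A(\delta,\delta'),\ A^+(\delta,\delta')\le M,\qquad \delta,\delta'\in\{0,1\}.$$ Let $g_0=\sum_{k\in\mathbb Z_+}g_0(k)z^k$ and $g_1=\sum_{k\in\mathbb Z_+}g_1(k)z^k$ be the generating functions $g_0((M,M),A^-,A,A^+)$ and $g_1((M,M),A^-,A,A^+)$ defined in the context. Assume that $$g_0(4)=g_1(4)\quad\text{and}\quad g_0(6)=g_1(6).$$ Then $$(A^-A^+)_{0,0}=(A^-A^+)_{1,1},\qquad (A^-AA^+)_{0,0}=(A^-AA^+)_{1,1},$$ and also $g_0=g_1$. Moreover, denoting by $\eta(4)$ the common value of $(A^-A^+)_{0,0}$ and $(A^-A^+)_{1,1}$, and by $\eta(6)$ the common value of $(A^-AA^+)_{0,0}$ and $(A^-AA^+)_{1,1}$, the common value $g$ of $g_0$ and $g_1$ satisfies $$ g(z)=z^2\left\{M+\frac{1}{g(z)^2\chi_A(g(z)^{-1})}\left[\eta(4)\,g(z)+\bigl(\eta(6)-\eta(4)\operatorname{tr}A\bigr)g(z)^2\right]\right\}. $$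
   Context: $\mathbb Z_+$ is the set of non-negative integers; $\chi_A$ is the characteristic polynomial of $A$, $\chi_A(x)=\det(x\mathbf 1-A)$. $[1,k]=\{1,\dots,k\}$ (empty for $k=0$). Consider the alphabet $\Sigma=\{\alpha^-(\delta,m),\alpha^+(\delta,m):\delta\in\{0,1\},\ 1\le m\le M\}$, with the multiplication rules $\alpha^-(\delta,m)\alpha^+(\delta',m')=1$ if $\delta=\delta'$, and $=0$ if $\delta\ne\delta'$. Let $Y\subset\Sigma^{\mathbb Z}$ be the subshift whose admissible words are the words $(\sigma_i)_{1\le i\le I}$ with $\prod_{1\le i\le I}\sigma_i\neq0$. Let $\mathcal F$ be the set of the following words of length two, for all $\delta,\delta'\in\{0,1\}$, $1\le m,m'\le M$: $\alpha^-(\delta,m)\alpha^-(\delta',m')$ with $m'\notin[1,A^-(\delta,\delta')]$; $\alpha^+(\delta,m)\alpha^-(\delta',m')$ with $m'\notin[1,A(\delta,\delta')]$; $\alpha^+(\delta,m)\alpha^+(\delta',m')$ with $m'\notin[1,A^+(\delta,\delta')]$. Let $X$ be the subshift of those points of $Y$ in which no word of $\mathcal F$ appears, and let $\mathcal L(X)$ be the set of words that appear in a point of $X$. Put $\rho(\alpha^-(\delta,m))=1$, $\rho(\alpha^+(\delta,m))=-1$. For $\delta\in\{0,1\}$, $1\le m\le M$ let $\mathcal C(\delta,m)$ be the set of words $c=(c_i)_{1\le i\le 2I}\in\mathcal L(X)$, $I\in\mathbb N$, such that $c_1=\alpha^-(\delta,m)$, $\sum_{1\le i\le2I}\rho(c_i)=0$,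 and $\sum_{1\le i\le 2J}\rho(c_i)>0$ for $1\le J<I$. The generating function of a set of words is $\sum_ka_kz^k$ with $a_k$ the number of its words of length $k$. The words of $\mathcal C(\delta,m)$ are taken to be those obtained from the words of $\mathcal C(\delta,1)$ by replacing the first symbol $\alpha^-(\delta,1)$ by $\alpha^-(\delta,m)$, and $g_\delta((M,M),A^-,A,A^+)$ denotes the common generating function of the codes $\mathcal C(\delta,m)$, $1\le m\le M$.
   Formalization: It is additionally assumed that the codes C(0,1) and C(1,1) are nonempty; without this the claim fails, e.g. for A^-=A=A^+=0, where X is empty, g_0=g_1=0 and g^{-1} is undefined, or for A^-=A^+=0, A=diag(0,1), where g_0=0 but g_1=Mz^2. *)

theory Defs
  imports "HOL-Analysis.Analysis" "HOL-Computational_Algebra.Formal_Laurent_Series"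
begin

text \<open>
  The index set \<open>{0,1}\<close> is the two-element type \<open>2\<close>, whose elements are \<open>0\<close> and \<open>1\<close>; a matrix
  \<open>(A(\<delta>,\<delta>'))\<close> is an element of \<open>nat ^ 2 ^ 2\<close> with entries \<open>A $ \<delta> $ \<delta>'\<close>.
\<close>

datatype symb = aminus 2 nat | aplus 2 nat

definition Sigma_alph :: "nat \<Rightarrow> symb set" where
  "Sigma_alph M = {s. \<exists>\<delta>. \<exists>m\<in>{1..M}. s = aminus \<delta> m \<or> s = aplus \<delta> m}"

text \<open>
  The multiplication rules present a monoid with zero. \<open>mon_eq M\<close> is the congruence they generate,
  where \<open>Some w\<close> stands for the product of the symbols of \<open>w\<close> and \<open>None\<close> for the zero element.
  The contexts \<open>u\<close>, \<open>v\<close> make the relation compatible with multiplication and make zero absorbing.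
\<close>

inductive mon_eq :: "nat \<Rightarrow> symb list option \<Rightarrow> symb list option \<Rightarrow> bool" for M where
  refl: "mon_eq M p p"
| sym: "mon_eq M p q \<Longrightarrow> mon_eq M q p"
| trans: "mon_eq M p q \<Longrightarrow> mon_eq M q r \<Longrightarrow> mon_eq M p r"
| one: "m \<in> {1..M} \<Longrightarrow> m' \<in> {1..M} \<Longrightarrow>
    mon_eq M (Some (u @ [aminus \<delta> m, aplus \<delta> m'] @ v)) (Some (u @ v))"
| zero: "m \<in> {1..M} \<Longrightarrow> m' \<in> {1..M} \<Longrightarrow> \<delta> \<noteq> \<delta>' \<Longrightarrow>
    mon_eq M (Some (u @ [aminus \<delta> m, aplus \<delta>' m'] @ v)) None"

definition prod_nonzero :: "nat \<Rightarrow> symb list \<Rightarrow> bool" where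
  "prod_nonzero M w \<longleftrightarrow> \<not> mon_eq M (Some w) None"

definition appears :: "symb list \<Rightarrow> (int \<Rightarrow> symb) \<Rightarrow> bool" where
  "appears w x \<longleftrightarrow> (\<exists>i. w = map (\<lambda>k. x (i + int k)) [0..<length w])"

definition shift_Y :: "nat \<Rightarrow> (int \<Rightarrow> symb) set" where
  "shift_Y M = {x. range x \<subseteq> Sigma_alph M \<and> (\<forall>w. appears w x \<longrightarrow> prod_nonzero M w)}"

definition forbidden ::
  "nat \<Rightarrow> nat ^ 2 ^ 2 \<Rightarrow> nat ^ 2 ^ 2 \<Rightarrow> nat ^ 2 ^ 2 \<Rightarrow> symb list set" where
  "forbidden M Am A Ap =
     {[aminus \<delta> m, aminus \<delta>' m'] | \<delta> \<delta>' m m'.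
        m \<in> {1..M} \<and> m' \<in> {1..M} \<and> m' \<notin> {1..Am $ \<delta> $ \<delta>'}} \<union>
     {[aplus \<delta> m, aminus \<delta>' m'] | \<delta> \<delta>' m m'.
        m \<in> {1..M} \<and> m' \<in> {1..M} \<and> m' \<notin> {1..A $ \<delta> $ \<delta>'}} \<union>
     {[aplus \<delta> m, aplus \<delta>' m'] | \<delta> \<delta>' m m'.
        m \<in> {1..M} \<and> m' \<in> {1..M} \<and> m' \<notin> {1..Ap $ \<delta> $ \<delta>'}}"

definition shift_X ::
  "nat \<Rightarrow> nat ^ 2 ^ 2 \<Rightarrow> nat ^ 2 ^ 2 \<Rightarrow> nat ^ 2 ^ 2 \<Rightarrow> (int \<Rightarrow> symb) set" where
  "shift_X M Am A Ap = {x \<in> shift_Y M. \<forall>w \<in> forbidden M Am A Ap. \<not> appears w x}"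

definition lang_X ::
  "nat \<Rightarrow> nat ^ 2 ^ 2 \<Rightarrow> nat ^ 2 ^ 2 \<Rightarrow> nat ^ 2 ^ 2 \<Rightarrow> symb list set" where
  "lang_X M Am A Ap = {w. \<exists>x \<in> shift_X M Am A Ap. appears w x}"

fun rho :: "symb \<Rightarrow> int" where
  "rho (aminus \<delta> m) = 1"
| "rho (aplus \<delta> m) = -1"

definition return_words ::
  "nat \<Rightarrow> nat ^ 2 ^ 2 \<Rightarrow> nat ^ 2 ^ 2 \<Rightarrow> nat ^ 2 ^ 2 \<Rightarrow> 2 \<Rightarrow> nat \<Rightarrow> symb list set" where
  "return_words M Am A Ap \<delta> m =
     {c \<in> lang_X M Am A Ap. \<exists>I\<ge>1. length c = 2 * I \<and> hd c = aminus \<delta> m \<and>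
        sum_list (map rho c) = 0 \<and>
        (\<forall>J. 1 \<le> J \<and> J < I \<longrightarrow> sum_list (map rho (take (2 * J) c)) > 0)}"

text \<open>
  Whether \<open>aminus \<delta> m\<close> has a predecessor in a point of the subshift depends on \<open>m\<close>. The code for
  general \<open>m\<close> is therefore taken to be the one for \<open>m = 1\<close> with the first symbol replaced, so that
  the generating function does not depend on \<open>m\<close> (\<open>gen_fun_code\<close> below).
\<close>

definition code ::
  "nat \<Rightarrow> nat ^ 2 ^ 2 \<Rightarrow> nat ^ 2 ^ 2 \<Rightarrow> nat ^ 2 ^ 2 \<Rightarrow> 2 \<Rightarrow> nat \<Rightarrow> symb list set" where
  "code M Am A Ap \<delta> m = (\<lambda>c. aminus \<delta> m # tl c) ` return_words M Am A Ap \<delta> 1"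

definition gen_fun :: "symb list set \<Rightarrow> rat fps" where
  "gen_fun C = Abs_fps (\<lambda>k. of_nat (card {c \<in> C. length c = k}))"

definition code_gf ::
  "nat \<Rightarrow> nat ^ 2 ^ 2 \<Rightarrow> nat ^ 2 ^ 2 \<Rightarrow> nat ^ 2 ^ 2 \<Rightarrow> 2 \<Rightarrow> rat fps" where
  "code_gf M Am A Ap \<delta> = gen_fun (code M Am A Ap \<delta> 1)"

lemma code_1: "code M Am A Ap \<delta> 1 = return_words M Am A Ap \<delta> 1"
proof -
  have "aminus \<delta> 1 # tl c = c" if "c \<in> return_words M Am A Ap \<delta> 1" for c
    using that by (cases c) (auto simp: return_words_def)
  then show ?thesis
    unfolding code_def by force
qed

lemma gen_fun_code: "gen_fun (code M Am A Ap \<delta> m) = code_gf M Am A Ap \<delta>"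
proof -
  have "card {c \<in> code M Am A Ap \<delta> m. length c = k} = card {c \<in> code M Am A Ap \<delta> 1. length c = k}"
    for k
    by (rule bij_betw_same_card[where f = "\<lambda>c. aminus \<delta> 1 # tl c"],
        rule bij_betw_byWitness[where f' = "\<lambda>c. aminus \<delta> m # tl c"])
      (auto simp: code_def)
  then show ?thesis
    by (simp add: gen_fun_def code_gf_def)
qed

definition charpoly :: "'a::comm_ring_1 ^ 'n ^ 'n \<Rightarrow> 'a poly" where
  "charpoly A = det (mat [:0, 1:] - map_matrix (\<lambda>a. [:a:]) A)"

end

theory Submission
  imports Defs
begin

text \<open>
  The symbols \<open>\<alpha>\<^sup>-\<close> and \<open>\<alpha>\<^sup>+\<close> are opening and closing brackets of two colours. A return word is
  an opening bracket, a sequence of return words \<open>c\<^sub>1 \<dots> c\<^sub>k\<close>, and a closing bracket of the same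
  colour. The matrices bound the index of the symbol that follows: \<open>A\<^sup>-\<close> when going from the opening
  bracket into \<open>c\<^sub>1\<close>, \<open>A\<close> between \<open>c\<^sub>i\<close> and \<open>c\<^sub>i\<^sub>+\<^sub>1\<close>, and \<open>A\<^sup>+\<close> when going from \<open>c\<^sub>k\<close> to the closing
  bracket. With \<open>G = diag(g\<^sub>0, g\<^sub>1)\<close> the generating functions therefore satisfy
  \<open>g\<^sub>\<delta> = z\<^sup>2 (M + (A\<^sup>- G (1 - A G)\<^sup>-\<^sup>1 A\<^sup>+)\<^sub>\<delta>\<^sub>\<delta>)\<close>. The recursion is the lemma \<open>closing_gf_rec\<close>, obtained
  from the grammar \<open>closes\<close> of words that close a level; the grammar is unambiguous because such words
  descend below their starting level at their last symbol only.

  The code consists of words that occur in bi-infinite points, so every word of the grammar must be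
  shown to extend to a point. This is where nonemptiness of the codes enters: if one return word
  \<open>c\<^sub>0\<close> occurs in a point, then replacing this occurrence by another word \<open>c\<close> of the grammar with the
  same first symbol gives a point again. The neighbours see only the first symbol and the colour of the
  last one, and both \<open>c\<close> and \<open>c\<^sub>0\<close> have product 1, so products of windows that contain the word do not
  change; every other window is a factor of such a window (\<open>good_exchange\<close>, \<open>closes_lang_X\<close>).

  The coefficient of \<open>z\<^sup>4\<close> in \<open>g\<^sub>\<delta>\<close> is \<open>M (A\<^sup>-A\<^sup>+)\<^sub>\<delta>\<^sub>\<delta>\<close>. The coefficient of \<open>z\<^sup>6\<close> is \<open>M\<^sup>2 (A\<^sup>-AA\<^sup>+)\<^sub>\<delta>\<^sub>\<delta>\<close> plus a
  term that is common to both colours once the fourth coefficients agree. This gives the two matrix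
  identities.
  For \<open>2 \<times> 2\<close> matrices the resolvent is explicit: with \<open>D = det (1 - A G)\<close>,
  \<open>D (g\<^sub>\<delta> - z\<^sup>2 M) = z\<^sup>2 (A\<^sup>- G A\<^sup>+ - g\<^sub>0 g\<^sub>1 A\<^sup>- adj(A) A\<^sup>+)\<^sub>\<delta>\<^sub>\<delta>\<close>, and \<open>adj(A) = tr(A) 1 - A\<close>. Hence the part with
  the adjugate is the same for both colours, the difference of the two equations has the factor
  \<open>g\<^sub>0 - g\<^sub>1\<close>, and the cofactor is a power series with constant term 1. So \<open>g\<^sub>0 = g\<^sub>1 = g\<close>, and for a
  common value \<open>D = 1 - tr(A) g + det(A) g\<^sup>2 = g\<^sup>2 \<chi>\<^sub>A(1/g)\<close>, which is the asserted equation.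
\<close>

(* Power series and vectors share the dollar sign; here it stands for entries of matrices only. *)
no_notation fps_nth (infixl "$" 75)

section \<open>Products in the monoid\<close>

text \<open>
  The generating rules of the congruence already carry contexts, so one context more is absorbed by
  them. Zero is mapped to zero, which makes factors of nonzero words nonzero.
\<close>

lemma mon_eq_context:
  assumes "mon_eq M p q"
  shows "mon_eq M (map_option (\<lambda>w. a @ w @ b) p) (map_option (\<lambda>w. a @ w @ b) q)"
  using assms
proof induction
  case (one m m' u \<delta> v)
  then show ?case
    using mon_eq.one[of m M m' "a @ u" \<delta> "v @ b"] by simp
next
  case (zero m m' \<delta> \<delta>' u v)
  then show ?case
    using mon_eq.zero[of m M m' \<delta> \<delta>' "a @ u" "v @ b"] by simp
qed (auto intro: mon_eq.refl mon_eq.sym mon_eq.trans)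

lemma prod_nonzero_factor:
  assumes "prod_nonzero M (a @ w @ b)"
  shows "prod_nonzero M w"
  using assms mon_eq_context[of M "Some w" None a b] by (auto simp: prod_nonzero_def)

lemma prod_nonzero_cong:
  assumes "mon_eq M (Some v) (Some w)"
  shows "prod_nonzero M (a @ v @ b) \<longleftrightarrow> prod_nonzero M (a @ w @ b)"
  using mon_eq_context[OF assms, of a b]
  by (auto simp: prod_nonzero_def intro: mon_eq.trans mon_eq.sym)

section \<open>Words that descend below their starting level at the end\<close>

definition first_descent :: "symb list \<Rightarrow> bool" where
  "first_descent w \<longleftrightarrow> sum_list (map rho w) = -1 \<and>
     (\<forall>k<length w. sum_list (map rho (take k w)) \<ge> 0)"

text \<open>
  Along such a word the height becomes negative exactly at the end, so no proper prefix has the same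
  property. This makes the decomposition of return words unique.
\<close>

lemma first_descent_prefix_free:
  assumes "first_descent v" "first_descent v'" "v @ w = v' @ w'"
  shows "v = v' \<and> w = w'"
proof -
  have nless: False if "first_descent a" "first_descent b" "a @ c = b @ d" "length a < length b"
    for a b c d
  proof -
    have "take (length a) (a @ c) = take (length a) (b @ d)"
      using that(3) by simp
    then have "a = take (length a) b"
      using that(4) by simp
    then show False
      using that(1,2,4) unfolding first_descent_def by (metis not_one_le_zero neg_0_le_iff_le)
  qed
  have "length v = length v'"
    using nless[OF assms(1,2,3)] nless[OF assms(2,1) assms(3)[symmetric]]
    by (meson linorder_neqE_nat)
  then show ?thesis
    using assms(3) by simp
qed

lemma sum_rho_parity: "even (sum_list (map rho w)) \<longleftrightarrow> even (length w)"
proof (induction w)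
  case (Cons s w)
  then show ?case by (cases s) auto
qed simp

lemma first_descent_singleton: "first_descent [aplus \<delta> m]"
  by (auto simp: first_descent_def)

lemma first_descent_Cons_append:
  assumes "first_descent v" "first_descent w"
  shows "first_descent (aminus \<delta> m # v @ w)"
  unfolding first_descent_def
proof (intro conjI allI impI)
  show "sum_list (map rho (aminus \<delta> m # v @ w)) = - 1"
    using assms by (simp add: first_descent_def)
next
  fix k assume k: "k < length (aminus \<delta> m # v @ w)"
  show "0 \<le> sum_list (map rho (take k (aminus \<delta> m # v @ w)))"
  proof (cases k)
    case (Suc j)
    have "sum_list (map rho (take j v)) \<ge> -1"
      using assms(1) by (cases "j < length v") (fastforce simp: first_descent_def)+
    moreover have "sum_list (map rho (take (j - length v) w)) \<ge> 0" if "j \<ge> length v"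
      using assms(2) k Suc that by (auto simp: first_descent_def)
    moreover have "sum_list (map rho v) = -1"
      using assms(1) by (simp add: first_descent_def)
    ultimately show ?thesis
      using Suc by (cases "j \<ge> length v") auto
  qed simp
qed

text \<open>
  After an opening symbol the height has to fall by two. The word is cut where the remainder falls by
  one for the first time; both pieces are then first descents.
\<close>

lemma first_descent_cases:
  assumes "first_descent w"
  obtains (plus) \<delta> m where "w = [aplus \<delta> m]"
  | (minus) \<delta> m v w' where "w = aminus \<delta> m # v @ w'" "first_descent v" "first_descent w'"
proof -
  from assms obtain s r where w: "w = s # r"
    by (cases w) (auto simp: first_descent_def)
  show thesis
  proof (cases s)
    case (aplus \<delta> m)
    have "r = []"
    proof (rule ccontr)
      assume "r \<noteq> []"
      then have "1 < length w"
        using w by simp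
      then have "sum_list (map rho (take 1 w)) \<ge> 0"
        using assms by (simp only: first_descent_def)
      then show False
        using w aplus by simp
    qed
    then show thesis
      using plus w aplus by simp
  next
    case (aminus \<delta> m)
    define S where "S k = sum_list (map rho (take k r))" for k
    have Sr: "S (length r) = -2"
      using assms w aminus by (simp add: S_def first_descent_def)
    have S_ge: "S k \<ge> -1" if "k < length r" for k
    proof -
      have "Suc k < length w"
        using that w by simp
      then have "sum_list (map rho (take (Suc k) w)) \<ge> 0"
        using assms by (simp only: first_descent_def)
      then show ?thesis
        using w aminus by (simp add: S_def)
    qed
    define n where "n = (LEAST k. S k < 0)"
    have Sn: "S n < 0"
      unfolding n_def by (rule LeastI[of _ "length r"]) (simp add: Sr)
    have before: "S k \<ge> 0" if "k < n" for k
      using not_less_Least[of k "\<lambda>k. S k < 0"] that by (simp add: n_def)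
    have n_le: "n \<le> length r"
      unfolding n_def by (rule Least_le) (simp add: Sr)
    have "n \<noteq> 0"
      using Sn by (intro notI) (simp add: S_def)
    then obtain n' where n': "n = Suc n'"
      by (cases n) auto
    \<comment> \<open>Heights change by one, so the first negative height is \<open>-1\<close>.\<close>
    have "S n = S n' + rho (r ! n')"
      using n_le n' by (simp add: S_def take_Suc_conv_app_nth)
    moreover have "rho (r ! n') \<ge> -1"
      by (cases "r ! n'") auto
    ultimately have Sn_eq: "S n = -1"
      using Sn before[of n'] n' by simp
    have fv: "first_descent (take n r)"
      using Sn_eq before n_le by (auto simp: first_descent_def S_def min_def)
    have S_drop: "sum_list (map rho (take k (drop n r))) = S (n + k) + 1" for k
      using Sn_eq by (simp add: S_def take_add)
    have "S (n + k) + 1 \<ge> 0" if "k < length r - n" for k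
      using S_ge[of "n + k"] that by (simp add: less_diff_conv add.commute)
    moreover have "sum_list (map rho (drop n r)) = -1"
      using S_drop[of "length r - n"] n_le Sr by simp
    ultimately have "first_descent (drop n r)"
      by (simp add: first_descent_def S_drop)
    with fv show thesis
      using minus[of \<delta> m "take n r" "drop n r"] w aminus by simp
  qed
qed

section \<open>Generating functions of sets of words\<close>

text \<open>
  The cardinality of an infinite set is zero, so the sum and product rules for generating functions
  need each length to occur finitely often.
\<close>

definition finite_levels :: "'a list set \<Rightarrow> bool" where
  "finite_levels C \<longleftrightarrow> (\<forall>k. finite {c \<in> C. length c = k})"

lemma finite_levels_subset:
  assumes "finite_levels D" "C \<subseteq> D"
  shows "finite_levels C"
  unfolding finite_levels_def
proof
  fix k
  show "finite {c \<in> C. length c = k}"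
    by (rule finite_subset[of _ "{c \<in> D. length c = k}"])
      (use assms in \<open>auto simp: finite_levels_def\<close>)
qed

lemma gen_fun_Un_disjoint:
  assumes "finite_levels C" "finite_levels D" "C \<inter> D = {}"
  shows "gen_fun (C \<union> D) = gen_fun C + gen_fun D"
proof (rule fps_ext)
  fix k
  have "{c \<in> C \<union> D. length c = k} = {c \<in> C. length c = k} \<union> {c \<in> D. length c = k}"
    by auto
  moreover have "card \<dots> = card {c \<in> C. length c = k} + card {c \<in> D. length c = k}"
    using assms by (intro card_Un_disjoint) (auto simp: finite_levels_def)
  ultimately show "fps_nth (gen_fun (C \<union> D)) k = fps_nth (gen_fun C + gen_fun D) k"
    by (simp add: gen_fun_def)
qed

lemma gen_fun_UNION_disjoint:
  assumes "finite I" "\<And>i. i \<in> I \<Longrightarrow> finite_levels (C i)"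
    and "\<And>i j. i \<in> I \<Longrightarrow> j \<in> I \<Longrightarrow> i \<noteq> j \<Longrightarrow> C i \<inter> C j = {}"
  shows "gen_fun (\<Union>i\<in>I. C i) = (\<Sum>i\<in>I. gen_fun (C i))"
proof (rule fps_ext)
  fix k
  have "{c \<in> \<Union>i\<in>I. C i. length c = k} = (\<Union>i\<in>I. {c \<in> C i. length c = k})"
    by auto
  moreover have "card \<dots> = (\<Sum>i\<in>I. card {c \<in> C i. length c = k})"
  proof (rule card_UN_disjoint[OF assms(1)])
    show "\<forall>i\<in>I. finite {c \<in> C i. length c = k}"
      using assms(2) by (auto simp: finite_levels_def)
    show "\<forall>i\<in>I. \<forall>j\<in>I. i \<noteq> j \<longrightarrow> {c \<in> C i. length c = k} \<inter> {c \<in> C j. length c = k} = {}"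
      using assms(3) by blast
  qed
  ultimately show "fps_nth (gen_fun (\<Union>i\<in>I. C i)) k = fps_nth (\<Sum>i\<in>I. gen_fun (C i)) k"
    by (simp add: gen_fun_def fps_sum_nth)
qed

lemma gen_fun_Cons: "gen_fun ((#) a ` C) = fps_X * gen_fun C"
proof (rule fps_ext)
  fix k
  show "fps_nth (gen_fun ((#) a ` C)) k = fps_nth (fps_X * gen_fun C) k"
  proof (cases k)
    case 0
    then show ?thesis by (auto simp: gen_fun_def)
  next
    case (Suc j)
    have "{c \<in> (#) a ` C. length c = Suc j} = (#) a ` {c \<in> C. length c = j}"
      by auto
    then show ?thesis
      using Suc by (simp add: gen_fun_def card_image)
  qed
qed

lemma gen_fun_append:
  assumes "finite_levels C" "finite_levels D" "inj_on (\<lambda>(v, w). v @ w) (C \<times> D)"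
  shows "gen_fun ((\<lambda>(v, w). v @ w) ` (C \<times> D)) = gen_fun C * gen_fun D"
proof (rule fps_ext)
  fix k
  let ?lev = "\<lambda>E n. {c \<in> E. length c = n}"
  let ?P = "\<Union>i\<in>{0..k}. ?lev C i \<times> ?lev D (k - i)"
  have "?lev ((\<lambda>(v, w). v @ w) ` (C \<times> D)) k = (\<lambda>(v, w). v @ w) ` ?P"
    by force
  moreover have "inj_on (\<lambda>(v, w). v @ w) ?P"
    by (rule inj_on_subset[OF assms(3)]) auto
  ultimately have "card (?lev ((\<lambda>(v, w). v @ w) ` (C \<times> D)) k) = card ?P"
    by (simp only: card_image)
  also have "\<dots> = (\<Sum>i\<in>{0..k}. card (?lev C i \<times> ?lev D (k - i)))"
    using assms(1,2) by (intro card_UN_disjoint) (auto simp: finite_levels_def)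
  finally show "fps_nth (gen_fun ((\<lambda>(v, w). v @ w) ` (C \<times> D))) k = fps_nth (gen_fun C * gen_fun D) k"
    by (simp add: gen_fun_def fps_mult_nth card_cartesian_product)
qed

section \<open>Windows of bi-infinite sequences\<close>

definition window :: "(int \<Rightarrow> symb) \<Rightarrow> int \<Rightarrow> nat \<Rightarrow> symb list" where
  "window x a n = map (\<lambda>k. x (a + int k)) [0..<n]"

lemma length_window [simp]: "length (window x a n) = n"
  by (simp add: window_def)

lemma appears_iff_window: "appears w x \<longleftrightarrow> (\<exists>a. w = window x a (length w))"
  by (simp add: appears_def window_def)

lemma window_add: "window x a (m + n) = window x a m @ window x (a + int m) n"
  by (rule nth_equalityI) (auto simp: window_def nth_append)

lemma window_factor:
  assumes "b \<le> a" "a + int n \<le> b + int m"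
  obtains u v where "window x b m = u @ window x a n @ v"
proof -
  define i where "i = nat (a - b)"
  define j where "j = nat (b + int m - (a + int n))"
  have m: "m = i + (n + j)" and a: "a = b + int i"
    using assms by (auto simp: i_def j_def)
  show thesis
    using that[of "window x b i" "window x (a + int n) j"] unfolding m a
    by (simp only: window_add)
qed

section \<open>The subshift through its windows\<close>

locale colored_dyck_shift =
  fixes M :: nat and Am A Ap :: "nat ^ 2 ^ 2"
  assumes M_pos: "M \<ge> 1"
    and Am_le: "Am $ \<delta> $ \<delta>' \<le> M"
    and A_le: "A $ \<delta> $ \<delta>' \<le> M"
    and Ap_le: "Ap $ \<delta> $ \<delta>' \<le> M"
begin

text \<open>
  The number of indices that a symbol of the kind of the second argument may have directly after
  the first argument. An opening symbol and a closing symbol directly after it have product zero unless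
  their colours agree, hence the last line. The value does not depend on the index of either symbol.
\<close>

fun cap :: "symb \<Rightarrow> symb \<Rightarrow> nat" where
  "cap (aminus \<delta> m) (aminus \<delta>' m') = Am $ \<delta> $ \<delta>'"
| "cap (aplus \<delta> m) (aminus \<delta>' m') = A $ \<delta> $ \<delta>'"
| "cap (aplus \<delta> m) (aplus \<delta>' m') = Ap $ \<delta> $ \<delta>'"
| "cap (aminus \<delta> m) (aplus \<delta>' m') = (if \<delta> = \<delta>' then M else 0)"

fun index :: "symb \<Rightarrow> nat" where
  "index (aminus \<delta> m) = m"
| "index (aplus \<delta> m) = m"

definition follows :: "symb \<Rightarrow> symb \<Rightarrow> bool" where
  "follows s t \<longleftrightarrow> index t \<in> {1..cap s t}"

lemma cap_le: "cap s t \<le> M"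
  by (cases s; cases t) (auto simp: Am_le A_le Ap_le)

lemma Sigma_iff_index: "t \<in> Sigma_alph M \<longleftrightarrow> index t \<in> {1..M}"
  by (cases t) (auto simp: Sigma_alph_def)

lemma follows_Sigma: "follows s t \<Longrightarrow> t \<in> Sigma_alph M"
  using cap_le[of s t] by (auto simp: follows_def Sigma_iff_index)

lemma follows_aminus_cong: "follows (aminus \<delta> m) = follows (aminus \<delta> m')"
proof
  fix t show "follows (aminus \<delta> m) t = follows (aminus \<delta> m') t"
    by (cases t) (auto simp: follows_def)
qed

lemma follows_aplus_cong: "follows (aplus \<delta> m) = follows (aplus \<delta> m')"
proof
  fix t show "follows (aplus \<delta> m) t = follows (aplus \<delta> m') t"
    by (cases t) (auto simp: follows_def)
qed

definition good :: "symb list \<Rightarrow> bool" where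
  "good w \<longleftrightarrow> set w \<subseteq> Sigma_alph M \<and> successively follows w \<and> prod_nonzero M w"

lemma good_factor: "good (u @ w @ v) \<Longrightarrow> good w"
  using prod_nonzero_factor by (auto simp: good_def successively_append_iff)

lemma follows_iff_pair:
  assumes "s \<in> Sigma_alph M" "t \<in> Sigma_alph M" "prod_nonzero M [s, t]"
  shows "follows s t \<longleftrightarrow> [s, t] \<notin> forbidden M Am A Ap"
proof (cases s)
  case s: (aminus \<delta> m)
  show ?thesis
  proof (cases t)
    case (aminus \<delta>' m')
    then show ?thesis
      using s assms by (auto simp: follows_def forbidden_def Sigma_iff_index)
  next
    case (aplus \<delta>' m')
    \<comment> \<open>No word in \<open>forbidden\<close> has this shape: the colours are matched by the monoid alone.\<close>
    have "\<delta> = \<delta>'"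
      using mon_eq.zero[of m M m' \<delta> \<delta>' "[]" "[]"] s aplus assms
      by (auto simp: prod_nonzero_def Sigma_iff_index)
    then show ?thesis
      using s aplus assms by (auto simp: follows_def forbidden_def Sigma_iff_index)
  qed
next
  case s: (aplus \<delta> m)
  then show ?thesis
    using assms by (cases t) (auto simp: follows_def forbidden_def Sigma_iff_index)
qed

text \<open>
  Membership in the subshift becomes one condition on finite words that is inherited by factors, so
  that it need be checked on a cofinal family of windows only.
\<close>

lemma shift_X_iff: "x \<in> shift_X M Am A Ap \<longleftrightarrow> (\<forall>a n. good (window x a n))"
proof
  assume x: "x \<in> shift_X M Am A Ap"
  have Sig: "x k \<in> Sigma_alph M" for k
    using x by (auto simp: shift_X_def shift_Y_def)
  have "appears (window x a n) x" for a n
    by (auto simp: appears_iff_window)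
  then have nz: "prod_nonzero M (window x a n)" for a n
    using x by (simp add: shift_X_def shift_Y_def)
  have pair: "window x k 2 = [x k, x (k + 1)]" for k
    by (simp add: window_def numeral_2_eq_2)
  have "[x k, x (k + 1)] \<notin> forbidden M Am A Ap" for k
  proof -
    have "appears [x k, x (k + 1)] x"
      unfolding appears_iff_window by (intro exI[of _ k]) (simp add: window_def)
    then show ?thesis
      using x by (auto simp: shift_X_def)
  qed
  then have fol: "follows (x k) (x (k + 1))" for k
    using follows_iff_pair[OF Sig Sig, of k "k + 1"] nz[of k 2] by (simp add: pair)
  show "\<forall>a n. good (window x a n)"
  proof (intro allI)
    fix a n
    have "successively follows (window x a n)"
      using fol[of "a + int _"] by (auto simp: successively_conv_nth window_def algebra_simps)
    then show "good (window x a n)"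
      using Sig nz by (auto simp: good_def window_def)
  qed
next
  assume x: "\<forall>a n. good (window x a n)"
  have Sig: "x k \<in> Sigma_alph M" for k
    using x[rule_format, of k 1] by (simp add: good_def window_def)
  have "\<not> appears w x" if w: "w \<in> forbidden M Am A Ap" for w
  proof
    assume "appears w x"
    then have "good w"
      using x by (metis appears_iff_window)
    moreover obtain s t where st: "w = [s, t]"
      using w by (auto simp: forbidden_def)
    ultimately show False
      using w follows_iff_pair[of s t] by (simp add: good_def)
  qed
  then show "x \<in> shift_X M Am A Ap"
    using x Sig by (auto simp: shift_X_def shift_Y_def appears_iff_window good_def)
      (metis)
qed

lemma lang_X_good: "w \<in> lang_X M Am A Ap \<Longrightarrow> good w"
  by (auto simp: lang_X_def appears_iff_window shift_X_iff) (metis)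

section \<open>The grammar of return words\<close>

text \<open>
  \<open>closes s \<delta> w\<close>: directly after the symbol \<open>s\<close>, the word \<open>w\<close> may complete a level that was opened with
  colour \<open>\<delta>\<close>, through a sequence of nested return words and a closing symbol of colour \<open>\<delta>\<close>. The
  preceding symbol is an argument because it limits the first index of \<open>w\<close>. If \<open>s\<close> is an opening
  symbol and \<open>w\<close> is a single symbol, \<open>follows\<close> forces the colour of \<open>s\<close> to be \<open>\<delta>\<close>. In the second rule
  \<open>aminus \<delta>' m # v\<close> is the first nested return word, and the rest continues after its last symbol.
\<close>

inductive closes :: "symb \<Rightarrow> 2 \<Rightarrow> symb list \<Rightarrow> bool" where
  close: "follows s (aplus \<delta> m) \<Longrightarrow> closes s \<delta> [aplus \<delta> m]"
| nest: "follows s (aminus \<delta>' m) \<Longrightarrow> closes (aminus \<delta>' m) \<delta>' v \<Longrightarrow>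
    closes (last v) \<delta> w \<Longrightarrow> closes s \<delta> (aminus \<delta>' m # v @ w)"

lemma closes_last: "closes s \<delta> w \<Longrightarrow> w \<noteq> [] \<and> (\<exists>m\<in>{1..M}. last w = aplus \<delta> m)"
  by (induction rule: closes.induct) (auto dest: follows_Sigma simp: Sigma_iff_index)

lemma closes_first_descent: "closes s \<delta> w \<Longrightarrow> first_descent w"
  by (induction rule: closes.induct) (auto intro: first_descent_singleton first_descent_Cons_append)

lemma closes_Sigma: "closes s \<delta> w \<Longrightarrow> set w \<subseteq> Sigma_alph M"
  by (induction rule: closes.induct) (auto dest: follows_Sigma)

lemma closes_successively: "closes s \<delta> w \<Longrightarrow> successively follows (s # w)"
proof (induction rule: closes.induct)
  case (nest s \<delta>' m v \<delta> w)
  moreover have "v \<noteq> []" "w \<noteq> []"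
    using nest closes_last by blast+
  ultimately show ?case
    by (auto simp: successively_append_iff successively_Cons)
qed simp

lemma closes_cong:
  assumes "follows s = follows s'"
  shows "closes s \<delta> w \<longleftrightarrow> closes s' \<delta> w"
  using assms by (subst (1 2) closes.simps) simp

text \<open>
  Each nested return word has product 1, so that only the final closing symbol survives.
\<close>

lemma closes_reduces: "closes s \<delta> w \<Longrightarrow> mon_eq M (Some w) (Some [last w])"
proof (induction rule: closes.induct)
  case (nest s \<delta>' m v \<delta> w)
  obtain m' where m': "m' \<in> {1..M}" "last v = aplus \<delta>' m'"
    using closes_last[OF nest.hyps(2)] by auto
  have "m \<in> {1..M}"
    using follows_Sigma[OF nest.hyps(1)] by (simp add: Sigma_iff_index)
  then have "mon_eq M (Some ([aminus \<delta>' m] @ [last v] @ w)) (Some w)"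
    using mon_eq.one[of m M m' "[]" \<delta>' w] m' by simp
  moreover have "mon_eq M (Some ([aminus \<delta>' m] @ v @ w)) (Some ([aminus \<delta>' m] @ [last v] @ w))"
    using mon_eq_context[OF nest.IH(1), of "[aminus \<delta>' m]" w] by simp
  moreover have "w \<noteq> []"
    using closes_last[OF nest.hyps(3)] by simp
  ultimately show ?case
    using nest.IH(2) by (auto intro: mon_eq.trans)
qed (simp add: mon_eq.refl)

text \<open>
  Converse of \<open>closes_first_descent\<close> and \<open>closes_successively\<close>. The shape of the word gives the
  nesting, and matching colours come from the product: a nested word reduces to its opening symbol
  times its last symbol, which is nonzero only if their colours agree.
\<close>

lemma first_descent_closes:
  assumes "first_descent w" "good (s # w)"
  shows "\<exists>\<delta>. closes s \<delta> w"
  using assms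
proof (induction "length w" arbitrary: s w rule: less_induct)
  case less
  from less.prems(1) show ?case
  proof (cases rule: first_descent_cases)
    case (plus \<delta> m)
    then show ?thesis
      using less.prems(2) by (auto simp: good_def intro: closes.close)
  next
    case (minus \<delta>' m v w')
    have g1: "good (aminus \<delta>' m # v)"
      using less.prems(2) good_factor[of "[s]" "aminus \<delta>' m # v" w'] minus by simp
    obtain \<delta>1 where v: "closes (aminus \<delta>' m) \<delta>1 v"
      using less.hyps[OF _ minus(2) g1] minus(1) by auto
    obtain m' where m': "m' \<in> {1..M}" "last v = aplus \<delta>1 m'" "v \<noteq> []"
      using closes_last[OF v] by auto
    have "prod_nonzero M ([aminus \<delta>' m] @ [aplus \<delta>1 m'] @ [])"
      using g1 prod_nonzero_cong[OF closes_reduces[OF v], of "[aminus \<delta>' m]" "[]"] m'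
      by (simp add: good_def)
    then have eq: "\<delta>1 = \<delta>'"
      using mon_eq.zero[of m M m' \<delta>' \<delta>1 "[]" "[]"] m' g1
      by (auto simp: prod_nonzero_def good_def Sigma_iff_index)
    have "v = butlast v @ [last v]"
      using m'(3) by simp
    then have "s # w = (s # aminus \<delta>' m # butlast v) @ (last v # w') @ []"
      using minus(1) by (metis append.assoc append_Cons append_Nil append_Nil2)
    then have "good (last v # w')"
      using less.prems(2) good_factor by metis
    then obtain \<delta> where "closes (last v) \<delta> w'"
      using less.hyps[OF _ minus(3)] minus(1) by fastforce
    moreover have "follows s (aminus \<delta>' m)"
      using less.prems(2) minus(1) by (simp add: good_def)
    ultimately show ?thesis
      using closes.nest v eq minus(1) by blast
  qed
qed

lemma closes_return_reduces:
  assumes "closes (aminus \<delta> m) \<delta> w" "m \<in> {1..M}"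
  shows "mon_eq M (Some (aminus \<delta> m # w)) (Some [])"
proof -
  obtain m' where m': "m' \<in> {1..M}" "last w = aplus \<delta> m'"
    using closes_last[OF assms(1)] by auto
  have "mon_eq M (Some (aminus \<delta> m # w)) (Some [aminus \<delta> m, aplus \<delta> m'])"
    using mon_eq_context[OF closes_reduces[OF assms(1)], of "[aminus \<delta> m]" "[]"] m' by simp
  moreover have "mon_eq M (Some [aminus \<delta> m, aplus \<delta> m']) (Some [])"
    using mon_eq.one[of m M m' "[]" \<delta> "[]"] m' assms(2) by simp
  ultimately show ?thesis
    by (rule mon_eq.trans)
qed

text \<open>
  A return word is required to have positive height at even positions only. By parity this forces
  the remainder after the first symbol to be a first descent, and the first symbol then determines
  the colour of the last one.
\<close>

lemma return_word_closes:
  assumes "c \<in> return_words M Am A Ap \<delta> 1"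
  obtains w where "c = aminus \<delta> 1 # w" "closes (aminus \<delta> 1) \<delta> w"
proof -
  from assms obtain I where I: "I \<ge> 1" "length c = 2 * I" "hd c = aminus \<delta> 1"
      "sum_list (map rho c) = 0"
      "\<And>J. 1 \<le> J \<Longrightarrow> J < I \<Longrightarrow> sum_list (map rho (take (2 * J) c)) > 0"
    and good: "good c"
    using lang_X_good by (auto simp: return_words_def)
  then obtain w where c: "c = aminus \<delta> 1 # w"
    by (cases c) auto
  have len: "Suc (length w) = 2 * I"
    using I(2) c by simp
  have odd_pre: "sum_list (map rho (take k w)) \<ge> 0" if "odd k" "k < length w" for k
  proof -
    from \<open>odd k\<close> obtain j where k: "k = Suc (2 * j)"
      by (auto elim: oddE)
    then have "sum_list (map rho (take (2 * Suc j) c)) > 0"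
      using I(5)[of "Suc j"] that len by simp
    then show ?thesis
      using c k by simp
  qed
  have "sum_list (map rho (take k w)) \<ge> 0" if k: "k < length w" for k
  proof (cases "odd k \<or> k = 0")
    case False
    then obtain j where j: "k = Suc j" "odd j"
      by (cases k) auto
    \<comment> \<open>A nonnegative height at an odd position is odd, hence at least one.\<close>
    have "odd (sum_list (map rho (take j w)))"
      using j k by (simp add: sum_rho_parity)
    then have "sum_list (map rho (take j w)) \<noteq> 0"
      by auto
    then have "sum_list (map rho (take j w)) \<ge> 1"
      using odd_pre[of j] j k by simp
    moreover have "rho (w ! j) \<ge> -1"
      by (cases "w ! j") auto
    ultimately show ?thesis
      using j k by (simp add: take_Suc_conv_app_nth)
  qed (use odd_pre k in auto)
  moreover have "sum_list (map rho w) = -1"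
    using I(4) c by simp
  ultimately have "first_descent w"
    by (simp add: first_descent_def)
  then obtain \<delta>' where w: "closes (aminus \<delta> 1) \<delta>' w"
    using first_descent_closes good c by blast
  obtain m' where m': "m' \<in> {1..M}" "last w = aplus \<delta>' m'"
    using closes_last[OF w] by auto
  have "prod_nonzero M ([aminus \<delta> 1] @ [last w] @ [])"
    using good prod_nonzero_cong[OF closes_reduces[OF w], of "[aminus \<delta> 1]" "[]"] c
    by (simp add: good_def)
  then have "\<delta>' = \<delta>"
    using mon_eq.zero[of 1 M m' \<delta> \<delta>' "[]" "[]"] m' M_pos by (auto simp: prod_nonzero_def)
  with w c that show thesis by blast
qed

text \<open>
  Both return words have product 1 in the monoid, so the product of the whole word stays the same up
  to congruence. At the seams nothing changes either, as the first symbols are equal and the last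
  symbols differ in their index at most, which puts no constraint on the next symbol.
\<close>

lemma good_exchange:
  assumes w: "closes (aminus \<delta> 1) \<delta> w" and w0: "closes (aminus \<delta> 1) \<delta> w0"
    and g: "good (p @ (aminus \<delta> 1 # w0) @ f)"
  shows "good (p @ (aminus \<delta> 1 # w) @ f)"
proof -
  have one: "1 \<in> {1..M}"
    using M_pos by simp
  obtain m m0 where last: "last w = aplus \<delta> m" "last w0 = aplus \<delta> m0" "w \<noteq> []" "w0 \<noteq> []"
    using closes_last[OF w] closes_last[OF w0] by auto
  have "prod_nonzero M (p @ [] @ f)"
    using g prod_nonzero_cong[OF closes_return_reduces[OF w0 one], of p f] by (simp add: good_def)
  then have "prod_nonzero M (p @ (aminus \<delta> 1 # w) @ f)"
    using prod_nonzero_cong[OF closes_return_reduces[OF w one], of p f] by simp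
  moreover have "successively follows (p @ (aminus \<delta> 1 # w) @ f)"
  proof -
    have "successively follows (p @ (aminus \<delta> 1 # w0) @ f)"
      using g by (simp add: good_def)
    then show ?thesis
      using closes_successively[OF w] last follows_aplus_cong[of \<delta> m m0]
      unfolding successively_append_iff by auto
  qed
  moreover have "set (p @ (aminus \<delta> 1 # w) @ f) \<subseteq> Sigma_alph M"
    using g closes_Sigma[OF w] by (auto simp: good_def)
  ultimately show ?thesis
    by (simp add: good_def)
qed

text \<open>
  One return word in the language provides a past and a future. The point for \<open>w\<close> is spliced from
  this past, the new word and this future.
\<close>

lemma closes_lang_X:
  assumes w: "closes (aminus \<delta> 1) \<delta> w" and w0: "closes (aminus \<delta> 1) \<delta> w0"
    and L: "aminus \<delta> 1 # w0 \<in> lang_X M Am A Ap"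
  shows "aminus \<delta> 1 # w \<in> lang_X M Am A Ap"
proof -
  let ?new = "aminus \<delta> 1 # w" and ?old = "aminus \<delta> 1 # w0"
  obtain x i where x: "x \<in> shift_X M Am A Ap" and c0: "?old = window x i (length ?old)"
    using L by (auto simp: lang_X_def appears_iff_window)
  define l where "l = length ?new"
  define l0 where "l0 = length ?old"
  define y where "y k = (if k < i then x k else if k < i + int l then ?new ! nat (k - i)
      else x (k - int l + int l0))" for k
  have past: "window y (i - int n) n = window x (i - int n) n" for n
    by (simp add: window_def y_def)
  have present: "window y i l = ?new"
    by (rule nth_equalityI) (auto simp: window_def y_def l_def simp del: upt_Suc)
  have future: "window y (i + int l) n = window x (i + int l0) n" for n
    by (simp add: window_def y_def algebra_simps)
  \<comment> \<open>Windows that contain the new word; every window is a factor of one of these.\<close>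
  have big: "good (window y (i - int n) (n + (l + n)))" for n
  proof -
    have "window x (i - int n) (n + (l0 + n)) = window x (i - int n) n @ ?old @ window x (i + int l0) n"
      using c0[folded l0_def] by (simp add: window_add)
    then have "good (window x (i - int n) n @ ?old @ window x (i + int l0) n)"
      using x by (metis shift_X_iff)
    then have "good (window x (i - int n) n @ ?new @ window x (i + int l0) n)"
      by (rule good_exchange[OF w w0])
    moreover have "window y (i - int n) (n + (l + n)) =
        window x (i - int n) n @ ?new @ window x (i + int l0) n"
      using past present future by (simp add: window_add)
    ultimately show ?thesis
      by simp
  qed
  have "good (window y a n)" for a n
  proof -
    define N where "N = nat \<bar>a - i\<bar> + n"
    have "i - int N \<le> a" "a + int n \<le> i - int N + int (N + (l + N))"
      by (auto simp: N_def)
    then obtain u v where "window y (i - int N) (N + (l + N)) = u @ window y a n @ v"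
      by (rule window_factor)
    then show ?thesis
      using big[of N] good_factor by metis
  qed
  then have "y \<in> shift_X M Am A Ap"
    by (simp add: shift_X_iff)
  moreover have "appears ?new y"
    unfolding appears_iff_window using present[symmetric] by (auto simp only: l_def)
  ultimately show ?thesis
    by (auto simp: lang_X_def)
qed

lemma return_words_eq:
  assumes "return_words M Am A Ap \<delta> 1 \<noteq> {}"
  shows "return_words M Am A Ap \<delta> 1 = (#) (aminus \<delta> 1) ` {w. closes (aminus \<delta> 1) \<delta> w}"
proof (intro equalityI subsetI)
  fix c assume "c \<in> return_words M Am A Ap \<delta> 1"
  then show "c \<in> (#) (aminus \<delta> 1) ` {w. closes (aminus \<delta> 1) \<delta> w}"
    by (rule return_word_closes) auto
next
  fix c assume "c \<in> (#) (aminus \<delta> 1) ` {w. closes (aminus \<delta> 1) \<delta> w}"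
  then obtain w where c: "c = aminus \<delta> 1 # w" and w: "closes (aminus \<delta> 1) \<delta> w"
    by auto
  obtain c0 where c0: "c0 \<in> return_words M Am A Ap \<delta> 1"
    using assms by auto
  obtain w0 where "c0 = aminus \<delta> 1 # w0" "closes (aminus \<delta> 1) \<delta> w0"
    using return_word_closes[OF c0] by blast
  then have "c \<in> lang_X M Am A Ap"
    using closes_lang_X[OF w] c0 c by (auto simp: return_words_def)
  moreover have fd: "first_descent w"
    by (rule closes_first_descent[OF w])
  then have sum: "sum_list (map rho c) = 0"
    using c by (simp add: first_descent_def)
  then have "even (length c)"
    using sum_rho_parity[of c] by simp
  then obtain I where I: "length c = 2 * I"
    by (auto elim: evenE)
  moreover have "sum_list (map rho (take (2 * J) c)) > 0" if "1 \<le> J" "J < I" for J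
  proof -
    from \<open>1 \<le> J\<close> obtain j where j: "2 * J = Suc j"
      by (cases J) auto
    then have "j < length w"
      using that I c by simp
    then have "sum_list (map rho (take j w)) \<ge> 0"
      using fd by (simp add: first_descent_def)
    then show ?thesis
      using j c by simp
  qed
  moreover have "I \<ge> 1"
    using I c by (cases I) auto
  ultimately show "c \<in> return_words M Am A Ap \<delta> 1"
    using sum c by (auto simp: return_words_def)
qed

section \<open>The recursion for the generating functions\<close>

definition closing_gf :: "symb \<Rightarrow> 2 \<Rightarrow> rat fps" where
  "closing_gf s \<delta> = gen_fun {w. closes s \<delta> w}"

lemma finite_levels_Sigma: "finite_levels {w. set w \<subseteq> Sigma_alph M}"
proof -
  have "Sigma_alph M = (\<lambda>(\<delta>, m). aminus \<delta> m) ` (UNIV \<times> {1..M}) \<union>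
      (\<lambda>(\<delta>, m). aplus \<delta> m) ` (UNIV \<times> {1..M})"
    by (force simp: Sigma_alph_def)
  then have "finite (Sigma_alph M)"
    by simp
  then show ?thesis
    by (simp add: finite_levels_def finite_lists_length_eq)
qed

text \<open>
  The admissible continuations of a symbol depend on its sign and colour only. In the recursion the
  preceding symbols are therefore normalised to index 1, and the choice of an index \<open>m\<close> contributes
  just a multiplicity.
\<close>

lemma closes_Collect:
  "{w. closes s \<delta> w} = (\<lambda>m. [aplus \<delta> m]) ` {1..cap s (aplus \<delta> 1)} \<union>
     (\<Union>(\<delta>', m) \<in> (SIGMA \<delta>':UNIV. {1..cap s (aminus \<delta>' 1)}). (#) (aminus \<delta>' m) `
        (\<lambda>(v, w). v @ w) ` ({v. closes (aminus \<delta>' 1) \<delta>' v} \<times> {w. closes (aplus \<delta>' 1) \<delta> w}))"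
    (is "_ = ?R")
proof -
  have cap: "cap s (aplus \<delta>1 m) = cap s (aplus \<delta>1 1)" "cap s (aminus \<delta>1 m) = cap s (aminus \<delta>1 1)"
    for \<delta>1 m by (cases s; simp)+
  have fol: "follows s (aplus \<delta>1 m) \<longleftrightarrow> m \<in> {1..cap s (aplus \<delta>1 1)}"
    "follows s (aminus \<delta>1 m) \<longleftrightarrow> m \<in> {1..cap s (aminus \<delta>1 1)}" for \<delta>1 m
    using cap[of \<delta>1 m] by (auto simp: follows_def)
  have eqv: "closes (aminus \<delta>1 m) \<delta>1 v \<longleftrightarrow> closes (aminus \<delta>1 1) \<delta>1 v" for \<delta>1 m v
    by (rule closes_cong[OF follows_aminus_cong])
  have eqw: "closes (last v) \<delta> w \<longleftrightarrow> closes (aplus \<delta>1 1) \<delta> w" if "closes (aminus \<delta>1 1) \<delta>1 v"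
    for \<delta>1 v w
    using closes_last[OF that] closes_cong[OF follows_aplus_cong] by metis
  show ?thesis
  proof (intro equalityI subsetI)
    fix u assume "u \<in> {w. closes s \<delta> w}"
    then have "closes s \<delta> u" by simp
    then show "u \<in> ?R"
    proof cases
      case (close m)
      then show ?thesis using fol by auto
    next
      case (nest \<delta>' m v w)
      have "closes (aminus \<delta>' 1) \<delta>' v"
        using nest(3) eqv by blast
      then have "v @ w \<in> (\<lambda>(v, w). v @ w) `
          ({v. closes (aminus \<delta>' 1) \<delta>' v} \<times> {w. closes (aplus \<delta>' 1) \<delta> w})"
        using nest(4) eqw by force
      then show ?thesis
        using nest(1,2) fol by (intro UnI2 UN_I[of "(\<delta>', m)"]) auto
    qed
  next
    fix u assume "u \<in> ?R"
    then show "u \<in> {w. closes s \<delta> w}"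
    proof (elim UnE)
      assume "u \<in> (\<lambda>m. [aplus \<delta> m]) ` {1..cap s (aplus \<delta> 1)}"
      then show ?thesis
        using fol by (auto intro: closes.close simp del: One_nat_def)
    next
      assume "u \<in> (\<Union>(\<delta>', m) \<in> (SIGMA \<delta>':UNIV. {1..cap s (aminus \<delta>' 1)}). (#) (aminus \<delta>' m) `
        (\<lambda>(v, w). v @ w) ` ({v. closes (aminus \<delta>' 1) \<delta>' v} \<times> {w. closes (aplus \<delta>' 1) \<delta> w}))"
      then obtain \<delta>' m v w where u: "u = aminus \<delta>' m # v @ w"
        and m: "m \<in> {1..cap s (aminus \<delta>' 1)}"
        and v: "closes (aminus \<delta>' 1) \<delta>' v" and w: "closes (aplus \<delta>' 1) \<delta> w"
        by (auto simp del: One_nat_def)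
      have "follows s (aminus \<delta>' m)"
        using m fol by blast
      moreover have "closes (aminus \<delta>' m) \<delta>' v"
        using v eqv by blast
      moreover have "closes (last v) \<delta> w"
        using w eqw[OF v] by blast
      ultimately show ?thesis
        using u closes.nest by blast
    qed
  qed
qed

text \<open>
  A closing word is a single closing symbol, or it consists of an opening symbol, the word that closes
  it, and a word that closes the outer level. Uniqueness of the cut is prefix-freeness of first
  descents, so concatenation becomes multiplication.
\<close>

lemma closing_gf_rec:
  "closing_gf s \<delta> = of_nat (cap s (aplus \<delta> 1)) * fps_X +
     (\<Sum>\<delta>'\<in>UNIV. of_nat (cap s (aminus \<delta>' 1)) *
        (fps_X * (closing_gf (aminus \<delta>' 1) \<delta>' * closing_gf (aplus \<delta>' 1) \<delta>)))"
proof -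
  let ?B = "(\<lambda>m. [aplus \<delta> m]) ` {1..cap s (aplus \<delta> 1)}"
  let ?I = "SIGMA \<delta>':UNIV. {1..cap s (aminus \<delta>' 1)}"
  let ?P = "\<lambda>\<delta>'. (\<lambda>(v, w). v @ w) `
    ({v. closes (aminus \<delta>' 1) \<delta>' v} \<times> {w. closes (aplus \<delta>' 1) \<delta> w})"
  let ?N = "\<lambda>(\<delta>', m). (#) (aminus \<delta>' m) ` ?P \<delta>'"
  have eq: "{w. closes s \<delta> w} = ?B \<union> \<Union> (?N ` ?I)"
    by (rule closes_Collect)
  have lev: "finite_levels {w. closes t \<delta>' w}" for t \<delta>'
    using closes_Sigma by (intro finite_levels_subset[OF finite_levels_Sigma]) blast
  have lev1: "finite_levels ?B" "finite_levels (\<Union> (?N ` ?I))"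
    by (rule finite_levels_subset[OF lev[of s \<delta>]], use eq in blast)+
  have lev2: "finite_levels (?N i)" if "i \<in> ?I" for i
    by (rule finite_levels_subset[OF lev1(2)]) (rule UN_upper[OF that])
  have base: "gen_fun ?B = of_nat (cap s (aplus \<delta> 1)) * fps_X"
  proof (rule fps_ext)
    fix k
    have "card ?B = cap s (aplus \<delta> 1)"
      by (subst card_image) (auto simp: inj_on_def)
    moreover have "{c \<in> ?B. length c = k} = (if k = 1 then ?B else {})"
      by auto
    ultimately have "fps_nth (gen_fun ?B) k = (if k = 1 then of_nat (cap s (aplus \<delta> 1)) else 0)"
      unfolding gen_fun_def fps_nth_Abs_fps by (simp only: card.empty of_nat_0 split: if_split) auto
    also have "\<dots> = fps_nth (fps_const (of_nat (cap s (aplus \<delta> 1))) * fps_X) k"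
      unfolding fps_mult_left_const_nth fps_X_nth by simp
    finally show "fps_nth (gen_fun ?B) k = fps_nth (of_nat (cap s (aplus \<delta> 1)) * fps_X) k"
      unfolding fps_of_nat .
  qed
  have prod: "gen_fun (?P \<delta>') = closing_gf (aminus \<delta>' 1) \<delta>' * closing_gf (aplus \<delta>' 1) \<delta>" for \<delta>'
    unfolding closing_gf_def
    by (rule gen_fun_append[OF lev lev])
      (auto simp: inj_on_def dest: first_descent_prefix_free[OF closes_first_descent closes_first_descent])
  have "closing_gf s \<delta> = gen_fun ?B + gen_fun (\<Union> (?N ` ?I))"
    unfolding closing_gf_def eq by (rule gen_fun_Un_disjoint[OF lev1]) auto
  also have "gen_fun (\<Union> (?N ` ?I)) = (\<Sum>i\<in>?I. gen_fun (?N i))"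
    by (rule gen_fun_UNION_disjoint[OF _ lev2]) auto
  also have "\<dots> = (\<Sum>(\<delta>', m)\<in>?I. fps_X * gen_fun (?P \<delta>'))"
    by (rule sum.cong) (auto simp: gen_fun_Cons)
  also have "\<dots> = (\<Sum>\<delta>'\<in>UNIV. \<Sum>m\<in>{1..cap s (aminus \<delta>' 1)}. fps_X * gen_fun (?P \<delta>'))"
    by (rule sum.Sigma[symmetric]) auto
  finally show ?thesis
    unfolding base prod by simp
qed

lemma code_gf_eq:
  assumes "code M Am A Ap \<delta> 1 \<noteq> {}"
  shows "code_gf M Am A Ap \<delta> = fps_X * closing_gf (aminus \<delta> 1) \<delta>"
proof -
  have "code M Am A Ap \<delta> 1 = (#) (aminus \<delta> 1) ` {w. closes (aminus \<delta> 1) \<delta> w}"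
    using return_words_eq assms unfolding code_1 by blast
  then show ?thesis
    by (simp add: code_gf_def closing_gf_def gen_fun_Cons)
qed

end


section \<open>Solving the recursion\<close>

lemma zero_one_of_type_2: "(0::2) \<noteq> 1" "(2::2) = 0"
  by simp_all

lemma UNIV_2_01: "(UNIV :: 2 set) = {0, 1}"
  using UNIV_2 zero_one_of_type_2 by auto

lemma sum_2_01: "sum f (UNIV :: 2 set) = f 0 + f 1"
  by (simp add: UNIV_2_01 zero_one_of_type_2)

text \<open>
  Cramer's rule for a linear system of size two. Here \<open>k0\<close> and \<open>k1\<close> form a column of
  \<open>(1 - A G)\<^sup>-\<^sup>1 x A\<^sup>+\<close> with \<open>A\<close> the matrix with rows \<open>(a, b)\<close> and \<open>(c, d)\<close>. Multiplication by
  \<open>det (1 - A G)\<close> eliminates them, and \<open>G adj(1 - A G) = G - g0 g1 adj(A)\<close> gives the right-hand side.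
\<close>

lemma resolvent_identity:
  fixes a b c d :: "'a::comm_ring_1"
  assumes "k0 = x * p0 + (a * (g0 * k0) + b * (g1 * k1))"
    and "k1 = x * p1 + (c * (g0 * k0) + d * (g1 * k1))"
    and "g = x\<^sup>2 * m + x * (m0 * (g0 * k0) + m1 * (g1 * k1))"
  shows "(1 - a * g0 - d * g1 + (a * d - b * c) * (g0 * g1)) * (g - x\<^sup>2 * m) =
    x\<^sup>2 * (m0 * p0 * g0 + m1 * p1 * g1 -
      (m0 * (d * p0 - b * p1) + m1 * (a * p1 - c * p0)) * (g0 * g1))"
proof -
  let ?D = "1 - a * g0 - d * g1 + (a * d - b * c) * (g0 * g1)"
  have xp: "x * p0 = k0 - a * (g0 * k0) - b * (g1 * k1)"
    "x * p1 = k1 - c * (g0 * k0) - d * (g1 * k1)"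
    using assms(1,2) by (simp_all add: algebra_simps)
  have k0: "?D * k0 = (1 - d * g1) * (x * p0) + b * g1 * (x * p1)"
    unfolding xp by (simp add: algebra_simps)
  have k1: "?D * k1 = c * g0 * (x * p0) + (1 - a * g0) * (x * p1)"
    unfolding xp by (simp add: algebra_simps)
  have "?D * (g - x\<^sup>2 * m) = x * (m0 * g0 * (?D * k0) + m1 * g1 * (?D * k1))"
    unfolding assms(3) by (simp add: algebra_simps)
  then show ?thesis
    unfolding k0 k1 by (simp add: algebra_simps power2_eq_square)
qed

text \<open>
  The fourth coefficient counts return words with one nested word of length two. In the sixth, the
  first term counts those with one nested word of length four, the second those with two nested words
  of length two.
\<close>

lemma low_coefficients:
  fixes g :: "2 \<Rightarrow> rat fps" and K :: "2 \<Rightarrow> 2 \<Rightarrow> rat fps" and Am A Ap :: "nat ^ 2 ^ 2"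
  assumes g: "\<And>\<delta>. g \<delta> = fps_X\<^sup>2 * of_nat M +
      fps_X * (\<Sum>\<delta>'\<in>UNIV. of_nat (Am $ \<delta> $ \<delta>') * (g \<delta>' * K \<delta>' \<delta>))"
    and K: "\<And>\<epsilon> \<delta>. K \<epsilon> \<delta> = fps_X * of_nat (Ap $ \<epsilon> $ \<delta>) +
      (\<Sum>\<delta>'\<in>UNIV. of_nat (A $ \<epsilon> $ \<delta>') * (g \<delta>' * K \<delta>' \<delta>))"
  shows "fps_nth (g \<delta>) 4 = of_nat (M * (Am ** Ap) $ \<delta> $ \<delta>)"
    and "fps_nth (g \<delta>) 6 = (\<Sum>\<delta>'\<in>UNIV. of_nat (Am $ \<delta> $ \<delta>' * Ap $ \<delta>' $ \<delta>) * fps_nth (g \<delta>') 4) +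
      of_nat (M\<^sup>2 * (Am ** A ** Ap) $ \<delta> $ \<delta>)"
proof -
  have gn: "fps_nth (g \<delta>) (Suc n) = (if n = 1 then of_nat M else 0) +
      (\<Sum>\<delta>'\<in>UNIV. of_nat (Am $ \<delta> $ \<delta>') * fps_nth (g \<delta>' * K \<delta>' \<delta>) n)" for \<delta> n
    by (subst g) (auto simp: fps_sum_nth power2_eq_square mult.assoc simp flip: fps_of_nat split: nat.split)
  have g0: "fps_nth (g \<delta>) 0 = 0" for \<delta>
    by (subst g) simp
  have Kn: "fps_nth (K \<epsilon> \<delta>) n = (if n = 1 then of_nat (Ap $ \<epsilon> $ \<delta>) else 0) +
      (\<Sum>\<delta>'\<in>UNIV. of_nat (A $ \<epsilon> $ \<delta>') * fps_nth (g \<delta>' * K \<delta>' \<delta>) n)" for \<epsilon> \<delta> n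
    by (subst K) (auto simp: fps_sum_nth simp flip: fps_of_nat)
  note conv = fps_mult_nth numeral_eq_Suc
  have K0: "fps_nth (K \<epsilon> \<delta>) 0 = 0" for \<epsilon> \<delta>
    by (subst Kn) (simp add: g0)
  have g1: "fps_nth (g \<delta>) (Suc 0) = 0" for \<delta>
    by (subst gn) (simp add: g0)
  have K1: "fps_nth (K \<epsilon> \<delta>) (Suc 0) = of_nat (Ap $ \<epsilon> $ \<delta>)" for \<epsilon> \<delta>
    by (subst Kn) (simp add: conv g0 g1)
  have g2: "fps_nth (g \<delta>) (Suc (Suc 0)) = of_nat M" for \<delta>
    by (subst gn) (simp add: conv g0 g1)
  have K2: "fps_nth (K \<epsilon> \<delta>) (Suc (Suc 0)) = 0" for \<epsilon> \<delta>
    by (subst Kn) (simp add: conv g0 g1 K0)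
  have g3: "fps_nth (g \<delta>) (Suc (Suc (Suc 0))) = 0" for \<delta>
    by (subst gn) (simp add: conv g0 g1 K0)
  have K3: "fps_nth (K \<epsilon> \<delta>) (Suc (Suc (Suc 0))) =
      (\<Sum>\<delta>'\<in>UNIV. of_nat (A $ \<epsilon> $ \<delta>') * (of_nat M * of_nat (Ap $ \<delta>' $ \<delta>)))" for \<epsilon> \<delta>
    by (subst Kn) (simp add: conv g0 g1 g2 K0 K1)
  have g4: "fps_nth (g \<delta>) (Suc (Suc (Suc (Suc 0)))) =
      (\<Sum>\<delta>'\<in>UNIV. of_nat (Am $ \<delta> $ \<delta>') * (of_nat M * of_nat (Ap $ \<delta>' $ \<delta>)))" for \<delta>
    by (subst gn) (simp add: conv g0 g1 g2 K0 K1)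
  have g5: "fps_nth (g \<delta>) (Suc (Suc (Suc (Suc (Suc 0))))) = 0" for \<delta>
    by (subst gn) (simp add: conv g0 g1 g2 g3 K0 K1 K2)
  have g6: "fps_nth (g \<delta>) (Suc (Suc (Suc (Suc (Suc (Suc 0)))))) =
      (\<Sum>\<delta>'\<in>UNIV. of_nat (Am $ \<delta> $ \<delta>') *
        (of_nat M * fps_nth (K \<delta>' \<delta>) 3 + fps_nth (g \<delta>') 4 * of_nat (Ap $ \<delta>' $ \<delta>)))" for \<delta>
    by (subst gn) (simp add: conv g0 g1 g2 g3 g5 K0 K1 K2)
  show "fps_nth (g \<delta>) 4 = of_nat (M * (Am ** Ap) $ \<delta> $ \<delta>)"
    using g4[of \<delta>] by (simp add: numeral_eq_Suc sum_2_01 matrix_matrix_mult_def algebra_simps)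
  show "fps_nth (g \<delta>) 6 = (\<Sum>\<delta>'\<in>UNIV. of_nat (Am $ \<delta> $ \<delta>' * Ap $ \<delta>' $ \<delta>) * fps_nth (g \<delta>') 4) +
      of_nat (M\<^sup>2 * (Am ** A ** Ap) $ \<delta> $ \<delta>)"
    using g6[of \<delta>] K3
    by (simp add: numeral_eq_Suc sum_2_01 matrix_matrix_mult_def power2_eq_square algebra_simps)
qed

text \<open>
  The reversed characteristic polynomial \<open>g\<^sup>2 \<chi>\<^sub>A(1/g)\<close> is \<open>det (1 - g A)\<close>.
\<close>

lemma poly_charpoly_inverse:
  fixes A :: "nat ^ 2 ^ 2" and g :: "'a::field"
  assumes "g \<noteq> 0"
  shows "g\<^sup>2 * poly (charpoly (map_matrix of_nat A)) (inverse g) =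
    1 - of_nat (A $ 0 $ 0) * g - of_nat (A $ 1 $ 1) * g +
      (of_nat (A $ 0 $ 0) * of_nat (A $ 1 $ 1) - of_nat (A $ 0 $ 1) * of_nat (A $ 1 $ 0)) * (g * g)"
proof -
  have "(2::2) = 0" "(1::2) \<noteq> 0"
    by simp_all
  then show ?thesis
    using assms
    by (simp only: charpoly_def det_2) (simp add: mat_def map_matrix_def field_simps power2_eq_square)
qed

theorem theorem3p2:
  fixes M :: nat and Am A Ap :: "nat ^ 2 ^ 2" and g0 g1 :: "rat fps"
  assumes "M \<ge> 1"
    and "\<And>\<delta> \<delta>'. Am $ \<delta> $ \<delta>' \<le> M"
    and "\<And>\<delta> \<delta>'. A $ \<delta> $ \<delta>' \<le> M"
    and "\<And>\<delta> \<delta>'. Ap $ \<delta> $ \<delta>' \<le> M"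
    and "\<And>\<delta>. code M Am A Ap \<delta> 1 \<noteq> {}"
    and "g0 = code_gf M Am A Ap 0"
    and "g1 = code_gf M Am A Ap 1"
    and "fps_nth g0 4 = fps_nth g1 4"
    and "fps_nth g0 6 = fps_nth g1 6"
  shows "(Am ** Ap) $ 0 $ 0 = (Am ** Ap) $ 1 $ 1 \<and>
    (Am ** A ** Ap) $ 0 $ 0 = (Am ** A ** Ap) $ 1 $ 1 \<and>
    g0 = g1 \<and>
    (let g = fps_to_fls g0 :: rat fls;
         eta4 = of_nat ((Am ** Ap) $ 0 $ 0) :: rat fls;
         eta6 = of_nat ((Am ** A ** Ap) $ 0 $ 0) :: rat fls;
         chi = charpoly (map_matrix of_nat A :: rat fls ^ 2 ^ 2)
     in g = fls_X ^ 2 * (of_nat M + 1 / (g ^ 2 * poly chi (inverse g)) *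
           (eta4 * g + (eta6 - eta4 * of_nat (trace A)) * g ^ 2)))"
proof -
  interpret colored_dyck_shift M Am A Ap
    using assms(1-4) by unfold_locales auto
  define g where "g \<delta> = code_gf M Am A Ap \<delta>" for \<delta>
  define K where "K \<epsilon> \<delta> = closing_gf (aplus \<epsilon> 1) \<delta>" for \<epsilon> \<delta>
  have g_closing: "g \<delta> = fps_X * closing_gf (aminus \<delta> 1) \<delta>" for \<delta>
    unfolding g_def by (rule code_gf_eq[OF assms(5)])
  have g_rec: "g \<delta> = fps_X\<^sup>2 * of_nat M +
      fps_X * (\<Sum>\<delta>'\<in>UNIV. of_nat (Am $ \<delta> $ \<delta>') * (g \<delta>' * K \<delta>' \<delta>))" for \<delta>
    unfolding g_closing K_def
    by (subst (1) closing_gf_rec) (simp add: algebra_simps power2_eq_square)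
  have K_rec: "K \<epsilon> \<delta> = fps_X * of_nat (Ap $ \<epsilon> $ \<delta>) +
      (\<Sum>\<delta>'\<in>UNIV. of_nat (A $ \<epsilon> $ \<delta>') * (g \<delta>' * K \<delta>' \<delta>))" for \<epsilon> \<delta>
    unfolding g_closing K_def by (subst (1) closing_gf_rec) (simp add: algebra_simps)
  have coeff: "fps_nth (g 0) 4 = fps_nth (g 1) 4" "fps_nth (g 0) 6 = fps_nth (g 1) 6"
    using assms(6-9) by (simp_all add: g_def)
  have eta4: "(Am ** Ap) $ 0 $ 0 = (Am ** Ap) $ 1 $ 1"
    using coeff(1) assms(1) unfolding low_coefficients(1)[OF g_rec K_rec]
    by (simp flip: of_nat_mult)
  have diag: "(Am ** Ap) $ \<delta> $ \<delta> =
      Am $ \<delta> $ 0 * Ap $ 0 $ \<delta> + Am $ \<delta> $ 1 * Ap $ 1 $ \<delta>" for \<delta>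
    by (simp add: matrix_matrix_mult_def sum_2_01)
  \<comment> \<open>Equal fourth coefficients make the first term of the sixth one depend on \<open>(A\<^sup>-A\<^sup>+)\<^sub>\<delta>\<^sub>\<delta>\<close> only.\<close>
  have "fps_nth (g \<delta>) 6 = of_nat ((Am ** Ap) $ \<delta> $ \<delta>) * fps_nth (g 0) 4 +
      of_nat (M\<^sup>2 * (Am ** A ** Ap) $ \<delta> $ \<delta>)" for \<delta>
    unfolding low_coefficients(2)[OF g_rec K_rec] sum_2_01 diag
    by (simp add: coeff(1) algebra_simps)
  then have "(of_nat (M\<^sup>2 * (Am ** A ** Ap) $ 0 $ 0) :: rat) = of_nat (M\<^sup>2 * (Am ** A ** Ap) $ 1 $ 1)"
    using coeff(2) eta4 by simp
  then have eta6: "(Am ** A ** Ap) $ 0 $ 0 = (Am ** A ** Ap) $ 1 $ 1"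
    using assms(1) unfolding of_nat_eq_iff by simp
  define f :: "nat \<Rightarrow> rat fps" where "f = of_nat"
  define e4 where "e4 = f ((Am ** Ap) $ 0 $ 0)"
  define e6 where "e6 = f ((Am ** A ** Ap) $ 0 $ 0)"
  define D where "D = 1 - f (A $ 0 $ 0) * g 0 - f (A $ 1 $ 1) * g 1 +
    (f (A $ 0 $ 0) * f (A $ 1 $ 1) - f (A $ 0 $ 1) * f (A $ 1 $ 0)) * (g 0 * g 1)"
  have bits: "\<delta> = 0 \<or> \<delta> = 1" for \<delta> :: 2
    using UNIV_2_01 by blast
  have "e4 = f ((Am ** Ap) $ \<delta> $ \<delta>)" for \<delta>
    using bits[of \<delta>] eta4 by (auto simp: e4_def)
  then have e4: "e4 = f (Am $ \<delta> $ 0) * f (Ap $ 0 $ \<delta>) + f (Am $ \<delta> $ 1) * f (Ap $ 1 $ \<delta>)" for \<delta>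
    by (simp add: f_def matrix_matrix_mult_def sum_2_01)
  have "e6 = f ((Am ** A ** Ap) $ \<delta> $ \<delta>)" for \<delta>
    using bits[of \<delta>] eta6 by (auto simp: e6_def)
  then have e6: "e6 = (f (Am $ \<delta> $ 0) * f (A $ 0 $ 0) + f (Am $ \<delta> $ 1) * f (A $ 1 $ 0)) * f (Ap $ 0 $ \<delta>) +
      (f (Am $ \<delta> $ 0) * f (A $ 0 $ 1) + f (Am $ \<delta> $ 1) * f (A $ 1 $ 1)) * f (Ap $ 1 $ \<delta>)" for \<delta>
    by (simp add: f_def matrix_matrix_mult_def sum_2_01)
  have res: "D * (g \<delta> - fps_X\<^sup>2 * f M) = fps_X\<^sup>2 *
      (f (Am $ \<delta> $ 0) * f (Ap $ 0 $ \<delta>) * g 0 + f (Am $ \<delta> $ 1) * f (Ap $ 1 $ \<delta>) * g 1 -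
        (e4 * (f (A $ 0 $ 0) + f (A $ 1 $ 1)) - e6) * (g 0 * g 1))" for \<delta>
  proof -
    \<comment> \<open>\<open>adj(A) = tr(A) 1 - A\<close>, sandwiched between \<open>A\<^sup>-\<close> and \<open>A\<^sup>+\<close>.\<close>
    have adj: "f (Am $ \<delta> $ 0) * (f (A $ 1 $ 1) * f (Ap $ 0 $ \<delta>) - f (A $ 0 $ 1) * f (Ap $ 1 $ \<delta>)) +
        f (Am $ \<delta> $ 1) * (f (A $ 0 $ 0) * f (Ap $ 1 $ \<delta>) - f (A $ 1 $ 0) * f (Ap $ 0 $ \<delta>)) =
        e4 * (f (A $ 0 $ 0) + f (A $ 1 $ 1)) - e6"
      unfolding e4[of \<delta>] e6[of \<delta>] by (simp add: algebra_simps)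
    show ?thesis
      unfolding D_def adj[symmetric]
      by (rule resolvent_identity[OF K_rec[of 0 \<delta>, unfolded sum_2_01, folded f_def]
          K_rec[of 1 \<delta>, unfolded sum_2_01, folded f_def]
          g_rec[of \<delta>, unfolded sum_2_01, folded f_def]])
  qed
  have g_zero: "fps_nth (g \<delta>) 0 = 0" for \<delta>
    by (simp add: g_closing)
  \<comment> \<open>Since \<open>e4\<close> is the same for both colours, the coefficients of \<open>g 0\<close> and \<open>g 1\<close> in the
    difference of the two equations are opposite to each other; \<open>\<kappa>\<close> is the latter.\<close>
  define \<kappa> where "\<kappa> = f (Am $ 0 $ 1) * f (Ap $ 1 $ 0) - f (Am $ 1 $ 1) * f (Ap $ 1 $ 1)"
  have "(g 0 - g 1) * (D + fps_X\<^sup>2 * \<kappa>) = 0"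
    using res[of 0] res[of 1] e4[of 0] e4[of 1] unfolding \<kappa>_def by algebra
  moreover have "fps_nth (D + fps_X\<^sup>2 * \<kappa>) 0 = 1"
    by (simp add: D_def g_zero)
  then have "D + fps_X\<^sup>2 * \<kappa> \<noteq> 0"
    by (metis fps_zero_nth zero_neq_one)
  ultimately have g01: "g 0 = g 1"
    by simp
  have closed: "D * (g 0 - fps_X\<^sup>2 * f M) = fps_X\<^sup>2 *
      (e4 * g 0 + (e6 - e4 * (f (A $ 0 $ 0) + f (A $ 1 $ 1))) * (g 0 * g 0))"
    using res[of 0] e4[of 0] unfolding g01[symmetric] by algebra
  have D0: "fps_nth D 0 = 1"
    by (simp add: D_def g_zero)
  then have "D \<noteq> 0"
    by auto
  have g_nz: "g 0 \<noteq> 0"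
  proof
    assume "g 0 = 0"
    then show False
      using closed \<open>D \<noteq> 0\<close> assms(1) by (simp add: f_def)
  qed
  define h where "h = fps_to_fls (g 0)"
  have h_nz: "h \<noteq> 0"
    using g_nz by (simp add: h_def)
  have of_nat_fls: "fps_to_fls (f n) = of_nat n" for n
    by (simp add: f_def fps_to_fls_of_nat)
  have D_fls: "h\<^sup>2 * poly (charpoly (map_matrix of_nat A)) (inverse h) = fps_to_fls D"
    unfolding poly_charpoly_inverse[OF h_nz] D_def g01[symmetric]
    by (simp add: h_def of_nat_fls fps_to_fls_plus fps_to_fls_minus fls_times_fps_to_fls)
  have "fps_to_fls D * (h - fls_X\<^sup>2 * of_nat M) = fls_X\<^sup>2 *
      (of_nat ((Am ** Ap) $ 0 $ 0) * h + (of_nat ((Am ** A ** Ap) $ 0 $ 0) -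
        of_nat ((Am ** Ap) $ 0 $ 0) * of_nat (trace A)) * h\<^sup>2)"
    using arg_cong[OF closed, of fps_to_fls]
    by (simp add: h_def of_nat_fls e4_def e6_def fps_to_fls_plus fps_to_fls_minus
        fls_times_fps_to_fls fps_to_fls_power trace_def sum_2_01 power2_eq_square)
  moreover have "fps_to_fls D \<noteq> 0"
    using \<open>D \<noteq> 0\<close> by simp
  ultimately have "h = fls_X\<^sup>2 * (of_nat M + 1 / fps_to_fls D *
      (of_nat ((Am ** Ap) $ 0 $ 0) * h + (of_nat ((Am ** A ** Ap) $ 0 $ 0) -
        of_nat ((Am ** Ap) $ 0 $ 0) * of_nat (trace A)) * h\<^sup>2))"
    by (simp add: field_simps)
  then have "h = fls_X\<^sup>2 * (of_nat M + 1 / (h\<^sup>2 * poly (charpoly (map_matrix of_nat A)) (inverse h)) *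
      (of_nat ((Am ** Ap) $ 0 $ 0) * h + (of_nat ((Am ** A ** Ap) $ 0 $ 0) -
        of_nat ((Am ** Ap) $ 0 $ 0) * of_nat (trace A)) * h\<^sup>2))"
    unfolding D_fls .
  then show ?thesis
    using eta4 eta6 g01 unfolding assms(6,7) g_def[symmetric] h_def[symmetric] Let_def by blast
qed

end
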